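(* Let $F$ be a field and let $P$ be a three-dimensional Poisson algebra over $F$ such that $\dim_F[P,P]=2$. Put $V=[P,P]$. Then $[V,V]=0$ and there exists $x\notin V$ such that $$P=Fx\oplus V,\qquad [x,v]=A(v)\quad(v\in V),$$ where $A\in GL(V)$. If $\operatorname{char}(F)\ne2$, the associative multiplication of $P$ is necessarily zero. If $\operatorname{char}(F)=2$, then either the associative multiplication is zero or $P$ has a basis $\{x,u,v\}$ such that $$[x,u]=u,\qquad [x,v]=v+qu,\qquad xv=u$$ for some $q\in F$, all remaining associative products of basis elements (other than $xv=vx=u$) being zero, and the remaining Lie bracket $[u,v]$ being zero.
   Context: A Poisson algebra over a field $F$ is an $F$-vector space $P$ with two $F$-bilinear operations: a commutative associative multiplication $(x,y)\mapsto xy$ (not assumed to have an identity) and a Lie multiplication $(x,y)\mapsto[x,y]$ (alternating, $[x,x]=0$ for all $x$, and satisfying the Jacobi identity), such that $[xy,z]=x[y,z]+y[x,z]$ for all $x,y,z\in P$. For subspaces $S,T$ of $P$, $[S,T]$ denotes the $F$-span of all $[s,t]$ with $s\in S$, $t\in T$; in particular $[P,P]$ is the derived Lie algebra. *)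

theory Defs
  imports Complex_Main
begin

text \<open>The underlying type \<^typ>\<open>'p\<close> is the whole algebra. The class \<^class>\<open>comm_ring\<close> supplies its
  additive group and its commutative associative multiplication, without assuming an identity.\<close>

locale poisson_algebra = vector_space scale
  for scale :: "'f::field \<Rightarrow> 'p::comm_ring \<Rightarrow> 'p" (infixr \<open>*s\<close> 75) +
  fixes lie :: "'p \<Rightarrow> 'p \<Rightarrow> 'p"
  assumes scale_mult_left: "(a *s x) * y = a *s (x * y)"
    and scale_mult_right: "x * (a *s y) = a *s (x * y)"
    and lie_add_left: "lie (x + y) z = lie x z + lie y z"
    and lie_add_right: "lie x (y + z) = lie x y + lie x z"
    and lie_scale_left: "lie (a *s x) y = a *s lie x y"
    and lie_scale_right: "lie x (a *s y) = a *s lie x y"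
    and lie_self: "lie x x = 0"
    and jacobi: "lie x (lie y z) + lie y (lie z x) + lie z (lie x y) = 0"
    and leibniz: "lie (x * y) z = x * lie y z + y * lie x z"

context vector_space
begin

definition bracket_span :: "('b \<Rightarrow> 'b \<Rightarrow> 'b) \<Rightarrow> 'b set \<Rightarrow> 'b set \<Rightarrow> 'b set" where
  "bracket_span lie S T = span {lie s t | s t. s \<in> S \<and> t \<in> T}"

definition is_direct_sum :: "'b set \<Rightarrow> 'b set \<Rightarrow> 'b set \<Rightarrow> bool" where
  "is_direct_sum W S T \<longleftrightarrow>
     subspace S \<and> subspace T \<and> S \<inter> T = {0} \<and> W = {s + t | s t. s \<in> S \<and> t \<in> T}"

text \<open>Membership constrains a map only on \<open>V\<close>; its values outside \<open>V\<close> are irrelevant.\<close>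

definition general_linear :: "'b set \<Rightarrow> ('b \<Rightarrow> 'b) set" where
  "general_linear V =
     {A. bij_betw A V V \<and> (\<forall>v\<in>V. \<forall>w\<in>V. A (v + w) = A v + A w) \<and>
         (\<forall>c. \<forall>v\<in>V. A (c *s v) = c *s A v)}"

end

end

theory Submission
  imports Defs
begin

text \<open>
  Let \<open>V = [P, P]\<close>, a Lie ideal of codimension one, and let \<open>x \<notin> V\<close>.

  \<^emph>\<open>Lie structure.\<close> If \<open>V\<close> were not abelian, then \<open>[V, V]\<close> would be a line \<open>F c\<close>, with
  \<open>[c, d] = e c\<close> for some \<open>e \<noteq> 0\<close> and some \<open>d\<close> completing \<open>c\<close> to a basis of \<open>V\<close>. The derivation
  \<open>ad x\<close> applied to \<open>[c, d] = e c\<close> then forces \<open>[x, c]\<close> and \<open>[x, d]\<close> onto the same line, so that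
  all of \<open>[P, P]\<close> is at most one-dimensional (\<open>derived_plane_abelian\<close>). Hence \<open>V\<close> is abelian,
  \<open>V = [x, V]\<close>, and the restriction \<open>A\<close> of \<open>ad x\<close> to the plane \<open>V\<close> is onto, therefore invertible.

  \<^emph>\<open>Associative structure.\<close> Expanding \<open>[x v, z]\<close> for \<open>v, z \<in> V\<close> by the Leibniz rule and using
  that \<open>A\<close> is onto shows that every \<open>v \<in> V\<close> acts on \<open>V\<close> by a scalar; by commutativity the scalar
  is zero, so \<open>V V = 0\<close> and \<open>x V \<subseteq> V\<close> (\<open>mult_V_zero\<close>). Likewise \<open>x x = \<alpha> x\<close>, and
  multiplication \<open>L\<close> by \<open>x\<close> on \<open>V\<close> satisfies \<open>2 L = \<alpha>\<close>. Associativity gives \<open>L\<^sup>2 = \<alpha> L\<close>, and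
  the two relations together force \<open>\<alpha> = 0\<close> in every characteristic (\<open>square_x_zero\<close>). What
  remains is \<open>2 L = 0\<close> and \<open>L\<^sup>2 = 0\<close>, with \<open>L\<close> commuting with \<open>A\<close>.

  Outside characteristic two this means \<open>L = 0\<close>, and all products vanish. If \<open>L \<noteq> 0\<close>, then \<open>L\<close>
  is a nilpotent of rank one on a plane, and \<open>A\<close>, commuting with \<open>L\<close>, has the form
  \<open>l \<cdot> id + q L\<close> with \<open>l \<noteq> 0\<close>. Rescaling \<open>x\<close> by \<open>1 / l\<close> and taking \<open>u = L v \<noteq> 0\<close> gives the
  normal form (\<open>nonzero_product_normal_form\<close>).
\<close>

section \<open>Spans of few vectors\<close>

context vector_space
begin

lemma mem_span_singleton_iff: "y \<in> span {u} \<longleftrightarrow> (\<exists>a. y = a *s u)"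
  by (auto simp: span_singleton)

lemma mem_span_pair_iff: "y \<in> span {u, v} \<longleftrightarrow> (\<exists>a b. y = a *s u + b *s v)"
  by (simp add: span_insert[of u] mem_span_singleton_iff diff_eq_eq add.commute)

text \<open>A nontrivial linear relation would make one of the two vectors a multiple of the other, and
  the span would collapse to a line.\<close>
lemma coefficients_zero_if_span_pair_not_line:
  assumes not_line: "\<And>w. \<not> span {p, q} \<subseteq> span {w}"
    and eq: "a *s p + b *s q = 0"
  shows "a = 0 \<and> b = 0"
proof -
  have nonzero_absurd: False
    if not_line: "\<And>w. \<not> span {p, q} \<subseteq> span {w}" and eq: "a *s p + b *s q = 0" and "a \<noteq> 0"
    for a b p q
  proof -
    have "a *s p = (- b) *s q"
      using eq by (simp add: eq_neg_iff_add_eq_0)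
    then have "inverse a *s a *s p = inverse a *s (- b) *s q" by simp
    then have "p = (inverse a * (- b)) *s q" using \<open>a \<noteq> 0\<close> by simp
    then have "p \<in> span {q}" unfolding mem_span_singleton_iff by (rule exI)
    then have "span {p, q} \<subseteq> span {q}" by (intro span_minimal) (auto simp: span_base)
    then show False using not_line by blast
  qed
  have "a = 0" using nonzero_absurd[OF assms] by blast
  moreover have "b = 0"
    using nonzero_absurd[of q p b a] assms by (auto simp: insert_commute add.commute)
  ultimately show ?thesis by simp
qed

lemma not_subset_line_if_dim_2:
  assumes "dim V = 2"
  shows "\<not> V \<subseteq> span {w}"
  using dim_le_card[of V "{w}"] assms by auto

lemma independent_pair:
  assumes "c \<noteq> 0" "d \<notin> span {c}"
  shows "independent {c, d}"
  using independent_insert[of d "{c}"] assms by (auto simp: insert_commute)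

lemma span_pair_eq_plane:
  assumes V: "subspace V" "dim V = 2"
    and mem: "c \<in> V" "d \<in> V" and "c \<noteq> 0" "d \<notin> span {c}"
  shows "V = span {c, d}"
proof -
  have "independent {c, d}" using assms(5,6) by (rule independent_pair)
  then obtain C where C: "{c, d} \<subseteq> C" "C \<subseteq> V" "independent C" "V \<subseteq> span C"
    using maximal_independent_subset_extend[of "{c, d}" V] mem by auto
  have "card C = 2" using basis_card_eq_dim[OF C(2,4,3)] V(2) by simp
  moreover have "d \<noteq> c" using assms(6) span_base[of c "{c}"] by auto
  ultimately have "{c, d} = C"
    using C(1) by (intro card_subset_eq) (auto intro: card_ge_0_finite)
  then show ?thesis using C V(1) by (metis span_subspace)
qed

text \<open>Extending a basis \<open>{u, v}\<close> of the plane to a basis of the whole space adds exactly one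
  vector.\<close>
lemma plane_and_complement_in_space:
  assumes V: "subspace V" "dim V = 2" and U: "dim (UNIV :: 'b set) = 3"
  obtains u v x where "V = span {u, v}" "x \<notin> V" "\<forall>y. \<exists>a. y - a *s x \<in> V"
proof -
  obtain B where B: "B \<subseteq> V" "independent B" "V \<subseteq> span B" "card B = dim V"
    by (rule basis_exists)
  then have "card B = 2" using V(2) by simp
  then obtain u v where uv: "B = {u, v}" unfolding card_2_iff by blast
  have VB: "V = span B" using span_subspace[OF B(1,3) V(1)] by (rule sym)
  obtain C where C: "B \<subseteq> C" "independent C" "UNIV \<subseteq> span C"
    using maximal_independent_subset_extend[of B UNIV] B(2) by auto
  have "card C = dim (UNIV :: 'b set)"
    by (rule basis_card_eq_dim) (use C in auto)
  then have "card (C - B) = 1"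
    using card_Diff_subset[of B C] C(1) \<open>card B = 2\<close> U uv by simp
  then obtain x where x: "C - B = {x}" by (rule card_1_singletonE)
  then have C_eq: "C = insert x B" and "x \<notin> B" using C(1) by auto
  have "x \<notin> V"
    using C(2) \<open>x \<notin> B\<close> unfolding VB C_eq independent_insert by (simp split: if_splits)
  moreover have "\<forall>y. \<exists>a. y - a *s x \<in> V"
  proof
    fix y
    have "y \<in> span (insert x B)" using C(3) unfolding C_eq by (rule subsetD) (rule UNIV_I)
    then show "\<exists>a. y - a *s x \<in> V" unfolding VB span_insert by (rule CollectD)
  qed
  moreover have "V = span {u, v}" using VB uv by (rule subst[rotated])
  ultimately show ?thesis by (intro that)
qed

end


section \<open>Lie brackets over a spanning set\<close>

context poisson_algebra
begin

lemma lie_zero_left [simp]: "lie 0 y = 0"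
  using lie_add_left[of 0 0 y] by simp

lemma lie_zero_right [simp]: "lie y 0 = 0"
  using lie_add_right[of y 0 0] by simp

lemma lie_antisym: "lie y x = - lie x y"
proof -
  have "lie (x + y) (x + y) = lie y x + lie x y"
    unfolding lie_add_left lie_add_right by (simp add: lie_self)
  then have "lie y x + lie x y = 0" unfolding lie_self by (rule sym)
  then show ?thesis by (rule eq_neg_iff_add_eq_0[THEN iffD2])
qed

lemma lie_minus_right: "lie x (- y) = - lie x y"
  using lie_add_right[of x y "- y"] by (simp add: eq_neg_iff_add_eq_0 add.commute)

text \<open>The Jacobi identity in the form that is used: \<open>ad x\<close> is a derivation of the Lie bracket.\<close>
lemma lie_derivation: "lie x (lie c d) = lie (lie x c) d + lie c (lie x d)"
proof -
  have "lie c (lie d x) = - lie c (lie x d)" "lie d (lie x c) = - lie (lie x c) d"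
    by (simp_all add: lie_antisym[of d x] lie_antisym[of d "lie x c"] lie_minus_right)
  then show ?thesis using jacobi[of x c d] by (simp add: algebra_simps)
qed

text \<open>The bracket is bilinear and alternating, so on a plane it is the determinant of the
  coordinates times \<open>[u, v]\<close>.\<close>
lemma lie_span_pair:
  assumes "s \<in> span {u, v}" "t \<in> span {u, v}"
  shows "lie s t \<in> span {lie u v}"
proof -
  obtain a b a' b' where s: "s = a *s u + b *s v" and t: "t = a' *s u + b' *s v"
    using assms by (auto simp: mem_span_pair_iff)
  have "lie s t = (a * b' - b * a') *s lie u v"
    unfolding s t using lie_antisym[of v u]
    by (simp add: lie_add_left lie_add_right lie_scale_left lie_scale_right lie_self
        algebra_simps)
  then show ?thesis by (auto simp: mem_span_singleton_iff)
qed

lemma bracket_span_subset: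
  assumes "\<And>y z. y \<in> S \<Longrightarrow> z \<in> T \<Longrightarrow> lie y z \<in> span X"
  shows "bracket_span lie S T \<subseteq> span X"
  unfolding bracket_span_def using assms by (intro span_minimal) auto

text \<open>The vector \<open>p\<close> accounts for the brackets inside the plane: it is \<open>0\<close> when \<open>u\<close> and \<open>v\<close>
  commute, and it spans the line \<open>[V, V]\<close> in the argument that excludes the nonabelian case.\<close>
lemma derived_algebra_subset_span:
  assumes dec: "\<And>y. \<exists>a. y - a *s x \<in> span {u, v}" and abel: "lie u v \<in> span {p}"
  shows "bracket_span lie UNIV UNIV \<subseteq> span {lie x u, lie x v, p}"
proof (rule bracket_span_subset)
  fix y z
  let ?W = "span {lie x u, lie x v, p}"
  obtain a where a: "y - a *s x \<in> span {u, v}" using dec by blast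
  obtain b where b: "z - b *s x \<in> span {u, v}" using dec by blast
  define s t where "s = y - a *s x" and "t = z - b *s x"
  then have y: "y = a *s x + s" and z: "z = b *s x + t" by simp_all
  have s: "s \<in> span {u, v}" and t: "t \<in> span {u, v}" using a b s_def t_def by auto
  have xW: "lie x w \<in> ?W" if "w \<in> span {u, v}" for w
  proof -
    obtain c d where "w = c *s u + d *s v" using \<open>w \<in> _\<close> by (auto simp: mem_span_pair_iff)
    then have "lie x w = c *s lie x u + d *s lie x v"
      by (simp add: lie_add_right lie_scale_right)
    moreover have "\<dots> \<in> ?W" by (intro span_add span_scale span_base) auto
    ultimately show ?thesis by simp
  qed
  have "span {lie u v} \<subseteq> span {p}"
    using abel by (intro span_minimal) auto
  moreover have "span {p} \<subseteq> ?W" by (intro span_mono) auto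
  ultimately have st: "lie s t \<in> ?W" using lie_span_pair[OF s t] by blast
  have "lie y z = a *s lie x t - b *s lie x s + lie s t"
    unfolding y z using lie_antisym[of s x]
    by (simp add: lie_add_left lie_add_right lie_scale_left lie_scale_right lie_self algebra_simps)
  then show "lie y z \<in> ?W"
    using xW[OF s] xW[OF t] st by (simp add: span_add span_diff span_scale)
qed

text \<open>If \<open>c = [u, v]\<close> were nonzero, it could be completed by some \<open>d\<close> to a basis of \<open>V\<close>, with
  \<open>[c, d] = e c\<close> and \<open>e \<noteq> 0\<close>. Comparing coefficients in \<open>[x, [c, d]] = [[x, c], d] + [c, [x, d]]\<close>
  shows that \<open>[x, c]\<close> and \<open>[x, d]\<close> have no \<open>d\<close>-component. Every bracket then lies in \<open>F c\<close>, which
  is too small to contain \<open>V\<close>.\<close>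
lemma derived_plane_abelian:
  assumes V: "V = bracket_span lie UNIV UNIV" and dimV: "dim V = 2"
    and Vuv: "V = span {u, v}" and dec: "\<And>y. \<exists>a. y - a *s x \<in> V"
  shows "lie u v = 0"
proof (rule ccontr)
  define c where "c = lie u v"
  assume "lie u v \<noteq> 0"
  then have c0: "c \<noteq> 0" by (simp add: c_def)
  have inV: "lie y z \<in> V" for y z
    unfolding V bracket_span_def by (intro span_base) auto
  have subV: "subspace V" unfolding Vuv by simp
  have cV: "c \<in> V" by (simp add: c_def inV)
  obtain d where d: "d \<in> V" "d \<notin> span {c}"
    using not_subset_line_if_dim_2[OF dimV, of c] by blast
  have Vcd: "V = span {c, d}" by (rule span_pair_eq_plane[OF subV dimV cV d(1) c0 d(2)])
  have nl: "\<not> span {c, d} \<subseteq> span {w}" for w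
    using not_subset_line_if_dim_2[OF dimV, of w] unfolding Vcd .
  obtain e where e: "lie c d = e *s c"
    using lie_span_pair[of c u v d] cV d unfolding Vuv c_def mem_span_singleton_iff by blast
  have e0: "e \<noteq> 0"
  proof
    assume "e = 0"
    then have "lie u v \<in> span {0}"
      using lie_span_pair[of u c d v] e Vuv Vcd span_base[of u "{u, v}"] span_base[of v "{u, v}"]
      by simp
    then show False using c0 by (simp add: c_def)
  qed
  obtain \<alpha> \<beta> where xc: "lie x c = \<alpha> *s c + \<beta> *s d"
    using inV[of x c] unfolding Vcd mem_span_pair_iff by blast
  obtain \<gamma> \<delta> where xd: "lie x d = \<gamma> *s c + \<delta> *s d"
    using inV[of x d] unfolding Vcd mem_span_pair_iff by blast
  have "e *s (\<alpha> *s c + \<beta> *s d) = (\<alpha> * e) *s c + (\<delta> * e) *s c"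
    using lie_derivation[of x c d]
    by (simp add: e xc xd lie_add_left lie_add_right lie_scale_left lie_scale_right lie_self)
  then have "(- \<delta> * e) *s c + (e * \<beta>) *s d = 0"
    by (simp add: algebra_simps)
  then have "\<delta> = 0" "\<beta> = 0"
    using coefficients_zero_if_span_pair_not_line[OF nl] e0 by fastforce+
  then have "{lie x c, lie x d, c} \<subseteq> span {c}"
    by (auto simp: xc xd span_base span_scale)
  then have "span {lie x c, lie x d, c} \<subseteq> span {c}"
    by (meson span_minimal subspace_span)
  moreover have "V \<subseteq> span {lie x c, lie x d, c}"
    unfolding V
  proof (rule derived_algebra_subset_span)
    show "\<exists>a. y - a *s x \<in> span {c, d}" for y using dec Vcd by simp
    show "lie c d \<in> span {c}" by (simp add: e span_base span_scale)
  qed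
  ultimately show False using not_subset_line_if_dim_2[OF dimV] by blast
qed

end


section \<open>Extensions of an abelian Lie ideal by an invertible derivation\<close>

text \<open>The situation after the Lie structure is known: \<open>P = F x \<oplus> V\<close> with \<open>V\<close> abelian and \<open>ad x\<close>
  invertible on \<open>V\<close>. Here \<open>V\<close> may have any dimension above one, which the commutativity argument
  for \<open>V V = 0\<close> requires; not being contained in a line is the form in which it is used.\<close>
locale poisson_abelian_extension = poisson_algebra scale lie
  for scale :: "'f::field \<Rightarrow> 'p::comm_ring \<Rightarrow> 'p" (infixr \<open>*s\<close> 75) and lie +
  fixes V :: "'p set" and x :: 'p
  assumes subspace_V: "subspace V"
    and not_line: "\<not> V \<subseteq> span {w}"
    and x_notin: "x \<notin> V"
    and decompose: "\<exists>a. y - a *s x \<in> V"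
    and lie_V: "v \<in> V \<Longrightarrow> w \<in> V \<Longrightarrow> lie v w = 0"
    and lie_x_bij: "bij_betw (lie x) V V"
begin

lemma lie_x_mem: "v \<in> V \<Longrightarrow> lie x v \<in> V"
  using lie_x_bij by (auto simp: bij_betw_def)

lemma lie_x_surj:
  assumes "w \<in> V"
  obtains v where "v \<in> V" "lie x v = w"
  using assms bij_betw_imp_surj_on[OF lie_x_bij] by (metis imageE)

lemma lie_x_inj: assumes "v \<in> V" "lie x v = 0" shows "v = 0"
  using inj_onD[of "lie x" V v 0] assms lie_x_bij subspace_0[OF subspace_V]
  by (auto simp: bij_betw_def)

lemma decomposeE: obtains a v where "v \<in> V" "y = a *s x + v"
proof -
  obtain a where "y - a *s x \<in> V" using decompose by blast
  then show ?thesis using that[of "y - a *s x" a] by simp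
qed

text \<open>For \<open>z \<in> V\<close> the Leibniz rule gives \<open>[x v, z] = v [x, z]\<close>, because \<open>v\<close> commutes with \<open>z\<close>. The
  left side depends only on the \<open>x\<close>-component \<open>c\<close> of \<open>x v\<close> and equals \<open>c [x, z]\<close>; and \<open>[x, z]\<close>
  runs through all of \<open>V\<close>.\<close>
lemma mult_V_scalar:
  assumes v: "v \<in> V"
  obtains c where "\<And>w. w \<in> V \<Longrightarrow> v * w = c *s w" "x * v - c *s x \<in> V"
proof -
  obtain c t where t: "t \<in> V" "x * v = c *s x + t" by (rule decomposeE)
  have "v * w = c *s w" if w: "w \<in> V" for w
  proof -
    obtain z where z: "z \<in> V" "lie x z = w" using lie_x_surj[OF w] .
    have "lie (x * v) z = x * lie v z + v * lie x z" by (rule leibniz)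
    then show ?thesis
      using z t v lie_V by (simp add: lie_add_left lie_scale_left)
  qed
  then show ?thesis using that[of c] t by simp
qed

text \<open>If \<open>v\<close> acts by \<open>c\<close> and \<open>w\<close> by \<open>d\<close>, then \<open>c w = v w = w v = d v\<close>. Choosing \<open>w\<close> outside the line
  through \<open>v\<close> gives \<open>c = 0\<close>.\<close>
lemma mult_V_zero:
  assumes v: "v \<in> V"
  shows "\<And>w. w \<in> V \<Longrightarrow> v * w = 0" "x * v \<in> V"
proof -
  obtain c where c: "\<And>w. w \<in> V \<Longrightarrow> v * w = c *s w" "x * v - c *s x \<in> V"
    using mult_V_scalar[OF v] by blast
  have "c = 0"
  proof (rule ccontr)
    assume c0: "c \<noteq> 0"
    obtain w where w: "w \<in> V" "w \<notin> span {v}" using not_line[of v] by blast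
    obtain d where d: "\<And>t. t \<in> V \<Longrightarrow> w * t = d *s t"
      using mult_V_scalar[OF w(1)] by metis
    have "c *s w = d *s v" using c(1)[OF w(1)] d[OF v] by (simp add: mult.commute)
    then have "inverse c *s c *s w = inverse c *s d *s v" by simp
    then have "w = (inverse c * d) *s v" using c0 by simp
    then show False using w(2) mem_span_singleton_iff by blast
  qed
  then show "\<And>w. w \<in> V \<Longrightarrow> v * w = 0" "x * v \<in> V" using c by simp_all
qed

text \<open>Since \<open>[x x, x] = 0\<close> and \<open>ad x\<close> is injective on \<open>V\<close>, the square of \<open>x\<close> has no component in
  \<open>V\<close>. The second relation is \<open>[x x, z] = 2 x [x, z]\<close> with \<open>w = [x, z]\<close>. It is written as a sum
  because \<open>2\<close> may vanish.\<close>
lemma square_x: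
  obtains \<alpha> where "x * x = \<alpha> *s x" "\<And>w. w \<in> V \<Longrightarrow> x * w + x * w = \<alpha> *s w"
proof -
  obtain \<alpha> t where t: "t \<in> V" "x * x = \<alpha> *s x + t" by (rule decomposeE)
  have "lie (x * x) x = 0" using leibniz[of x x x] by (simp add: lie_self)
  then have "lie t x = 0" using t by (simp add: lie_add_left lie_scale_left lie_self)
  then have "lie x t = 0" using lie_antisym[of x t] by simp
  then have "t = 0" using lie_x_inj t by blast
  then have sq: "x * x = \<alpha> *s x" using t by simp
  have "x * w + x * w = \<alpha> *s w" if w: "w \<in> V" for w
  proof -
    obtain z where z: "z \<in> V" "lie x z = w" using lie_x_surj[OF w] .
    then show ?thesis using leibniz[of x x z] by (simp add: sq lie_scale_left)
  qed
  with sq show ?thesis using that by blast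
qed

text \<open>With \<open>L\<close> the multiplication by \<open>x\<close> on \<open>V\<close>, the relations \<open>2 L = \<alpha>\<close> and \<open>L\<^sup>2 = \<alpha> L\<close> give
  \<open>\<alpha>\<^sup>2 = 2 \<alpha> L = 2 L\<^sup>2 = \<alpha> L\<close>. If \<open>\<alpha>\<close> were nonzero, then \<open>L = \<alpha> = 2 L\<close>, so \<open>L = 0\<close>
  and \<open>\<alpha> = 0\<close>. This argument is uniform in the characteristic.\<close>
lemma square_x_zero: "x * x = 0"
proof -
  obtain \<alpha> where sq: "x * x = \<alpha> *s x" and dbl: "\<And>w. w \<in> V \<Longrightarrow> x * w + x * w = \<alpha> *s w"
    using square_x by blast
  obtain w where w: "w \<in> V" "w \<notin> span {0}" using not_line[of 0] by blast
  then have w0: "w \<noteq> 0" by auto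
  have "\<alpha> *s \<alpha> *s w = \<alpha> *s (x * w) + \<alpha> *s (x * w)"
    using dbl[OF w(1)] by (metis scale_right_distrib)
  also have "\<alpha> *s (x * w) = x * (x * w)"
    using sq by (metis mult.assoc scale_mult_left)
  also have "x * (x * w) + x * (x * w) = \<alpha> *s (x * w)"
    by (rule dbl) (rule mult_V_zero[OF w(1)])
  finally have e: "\<alpha> *s \<alpha> *s w = \<alpha> *s (x * w)" .
  have "\<alpha> = 0"
  proof (rule ccontr)
    assume a: "\<alpha> \<noteq> 0"
    then have "\<alpha> *s w = x * w" using e unfolding scale_cancel_left by simp
    with dbl[OF w(1)] have "\<alpha> *s w = 0" by simp
    then show False using a w0 by simp
  qed
  then show ?thesis using sq by simp
qed

lemma double_mult_x: "w \<in> V \<Longrightarrow> x * w + x * w = 0"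
proof -
  assume w: "w \<in> V"
  obtain \<alpha> where sq: "x * x = \<alpha> *s x" and dbl: "\<And>w. w \<in> V \<Longrightarrow> x * w + x * w = \<alpha> *s w"
    using square_x by blast
  have "x \<noteq> 0" using x_notin subspace_0[OF subspace_V] by auto
  then have "\<alpha> = 0" using sq square_x_zero by simp
  then show ?thesis using dbl[OF w] by simp
qed

lemma mult_zero_if_mult_x_zero:
  fixes a b :: 'p
  assumes "\<And>w. w \<in> V \<Longrightarrow> x * w = 0"
  shows "a * b = 0"
proof -
  obtain p v where a: "v \<in> V" "a = p *s x + v" by (rule decomposeE)
  obtain r w where b: "w \<in> V" "b = r *s x + w" by (rule decomposeE)
  show ?thesis unfolding a b
    using assms[OF a(1)] assms[OF b(1)] mult_V_zero(1)[OF a(1) b(1)] mult.commute[of v x]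
    by (simp add: ring_distribs scale_mult_left scale_mult_right square_x_zero)
qed

lemma mult_zero_if_char_neq_2:
  fixes a b :: 'p
  assumes "CHAR('f) \<noteq> 2"
  shows "a * b = 0"
proof (rule mult_zero_if_mult_x_zero)
  fix w assume "w \<in> V"
  have "(2 :: 'f) \<noteq> 0"
  proof
    assume "(2 :: 'f) = 0"
    then have "of_nat 2 = (0 :: 'f)" by simp
    then have "CHAR('f) dvd 2" by (simp only: of_nat_eq_0_iff_char_dvd)
    moreover have "CHAR('f) \<noteq> 1" by simp
    moreover have "CHAR('f) \<noteq> 0"
    proof
      assume "CHAR('f) = 0"
      with \<open>CHAR('f) dvd 2\<close> show False by simp
    qed
    moreover have "CHAR('f) \<le> 2" using \<open>CHAR('f) dvd 2\<close> by (simp add: dvd_imp_le)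
    ultimately show False using assms by linarith
  qed
  moreover have "2 *s (x * w) = 0"
    using double_mult_x[OF \<open>w \<in> V\<close>] scale_left_distrib[of 1 1 "x * w"] by simp
  ultimately show "x * w = 0" by simp
qed

text \<open>The Leibniz rule for \<open>[x w, x]\<close>: multiplication by \<open>x\<close> commutes with \<open>ad x\<close>.\<close>
lemma mult_x_commutes_lie_x: "lie x (x * w) = x * lie x w"
  using leibniz[of x w x] lie_antisym[of x w] lie_antisym[of x "x * w"]
  by (simp add: lie_self)

lemma mult_x_mult_x: "x * (x * w) = 0"
  by (metis mult.assoc square_x_zero mult_zero_left)

text \<open>Multiplication \<open>L\<close> by \<open>x\<close> is nonzero on \<open>V\<close>; pick \<open>v\<close> with \<open>u = x v \<noteq> 0\<close>, so that \<open>L u = 0\<close>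
  and \<open>{u, v}\<close> is a basis of the plane. As \<open>ad x\<close> commutes with \<open>L\<close>, it preserves the kernel
  \<open>F u\<close> of \<open>L\<close> and has the same eigenvalue \<open>l\<close> on \<open>F u\<close> as on \<open>V / F u\<close>; it is invertible, so
  \<open>l \<noteq> 0\<close>. Replacing \<open>x\<close> by \<open>x / l\<close>, and with it \<open>u\<close> by \<open>u / l\<close>, turns \<open>l\<close> into \<open>1\<close>.
  The coefficient \<open>q\<close> is unchanged, since it is divided by \<open>l\<close> together with \<open>u\<close>.\<close>
lemma nonzero_product_normal_form:
  fixes a b :: 'p
  assumes dimV: "dim V = 2" and nz: "a * b \<noteq> 0"
  obtains u v y q where
    "V = span {u, v}" "y \<notin> V" "\<forall>z. \<exists>a. z - a *s y \<in> V"
    "lie y u = u" "lie y v = v + q *s u" "lie u v = 0" "y * v = u"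
    "y * y = 0" "y * u = 0" "u * u = 0" "u * v = 0" "v * v = 0"
proof -
  obtain v where v: "v \<in> V" "x * v \<noteq> 0" using mult_zero_if_mult_x_zero nz by blast
  define u where "u = x * v"
  have u: "u \<in> V" "u \<noteq> 0" "x * u = 0"
    using v mult_V_zero by (auto simp: u_def mult_x_mult_x)
  have "v \<notin> span {u}"
    using u v by (auto simp: mem_span_singleton_iff scale_mult_right)
  then have Vuv: "V = span {u, v}"
    by (intro span_pair_eq_plane[OF subspace_V dimV u(1) v(1) u(2)])
  obtain l m where lu: "lie x u = l *s u + m *s v"
    using lie_x_mem[OF u(1)] unfolding Vuv mem_span_pair_iff by blast
  obtain q k where lv: "lie x v = q *s u + k *s v"
    using lie_x_mem[OF v(1)] unfolding Vuv mem_span_pair_iff by blast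
  (* Multiply [x, u] by x: the u-component is annihilated and v becomes u. *)
  have "m *s u = 0"
    using mult_x_commutes_lie_x[of u] u(3) lu
    by (simp add: ring_distribs scale_mult_right u_def[symmetric])
  then have m: "m = 0" using u by simp
  (* Here [x, u] = [x, x v] = x [x, v], and multiplication by x annihilates the u-component. *)
  have "lie x u = k *s u"
    using mult_x_commutes_lie_x[of v] u(3) lv
    by (simp add: ring_distribs scale_mult_right u_def[symmetric])
  with lu m have kl: "k *s u = l *s u" by simp
  then have k: "k = l" using u by simp
  have l0: "l \<noteq> 0" using lie_x_inj[OF u(1)] u(2) lu m by auto
  define y u' where "y = inverse l *s x" and "u' = inverse l *s u"
  have u': "u' \<in> V" "u' \<noteq> 0" using u l0 subspace_scale[OF subspace_V] by (auto simp: u'_def)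
  have x_y: "x = l *s y" using l0 by (simp add: y_def)
  have "v \<notin> span {u'}"
    using \<open>v \<notin> span {u}\<close> unfolding mem_span_singleton_iff u'_def by auto
  show ?thesis
  proof (rule that[of u' v y q])
    show "V = span {u', v}"
      by (rule span_pair_eq_plane[OF subspace_V dimV u'(1) v(1) u'(2)]) fact
    show "y \<notin> V" using x_notin subspace_scale[OF subspace_V, of y l] x_y by auto
    show "\<forall>z. \<exists>a. z - a *s y \<in> V"
    proof
      fix z
      obtain a where "z - a *s x \<in> V" using decompose by blast
      then have "z - (a * l) *s y \<in> V" by (simp add: x_y)
      then show "\<exists>a. z - a *s y \<in> V" by (rule exI)
    qed
    show "lie y u' = u'"
      using lu m l0 by (simp add: y_def u'_def lie_scale_left lie_scale_right)
    show "lie y v = v + q *s u'"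
      using lv k l0 by (simp add: y_def u'_def lie_scale_left scale_right_distrib mult.commute add.commute)
    show "lie u' v = 0" using lie_V u' v by simp
    show "y * v = u'" by (simp add: y_def u'_def u_def scale_mult_left)
    show "y * y = 0" by (simp add: y_def scale_mult_left scale_mult_right square_x_zero)
    show "y * u' = 0" by (simp add: y_def u'_def scale_mult_left scale_mult_right u(3))
    show "u' * u' = 0" "u' * v = 0" "v * v = 0" using mult_V_zero u' v by auto
  qed
qed

end


section \<open>The classification\<close>

context poisson_algebra
begin

text \<open>As \<open>V\<close> is abelian, \<open>V = [P, P]\<close> is spanned by \<open>[x, u]\<close> and \<open>[x, v]\<close>. Two vectors that span a
  plane are independent, which makes \<open>ad x\<close> both onto and injective on \<open>V\<close>.\<close>
lemma abelian_extension_if_derived_plane: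
  assumes U: "dim (UNIV :: 'p set) = 3"
    and V: "V = bracket_span lie UNIV UNIV" and dimV: "dim V = 2"
  obtains x where "poisson_abelian_extension scale lie V x"
proof -
  have subV: "subspace V" unfolding V bracket_span_def by simp
  obtain u v x where xuv: "V = span {u, v}" "x \<notin> V" and all_dec: "\<forall>y. \<exists>a. y - a *s x \<in> V"
    by (rule plane_and_complement_in_space[OF subV dimV U])
  note dec = all_dec[rule_format]
  have uv: "lie u v = 0" by (rule derived_plane_abelian[OF V dimV xuv(1) dec])
  have inV: "lie y z \<in> V" for y z
    unfolding V bracket_span_def by (intro span_base) auto
  have "V \<subseteq> span {lie x u, lie x v, 0}"
    unfolding V
  proof (rule derived_algebra_subset_span)
    show "\<exists>a. y - a *s x \<in> span {u, v}" for y using dec[of y] unfolding xuv(1) .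
    show "lie u v \<in> span {0}" by (simp add: uv)
  qed
  also have "{lie x u, lie x v, 0} = insert 0 {lie x u, lie x v}" by auto
  also have "span \<dots> = span {lie x u, lie x v}" by (rule span_insert_0)
  finally have V_sub: "V \<subseteq> span {lie x u, lie x v}" .
  then have nl: "\<not> span {lie x u, lie x v} \<subseteq> span {w}" for w
    using not_subset_line_if_dim_2[OF dimV, of w] by auto
  have lie_comb: "lie x (a *s u + b *s v) = a *s lie x u + b *s lie x v" for a b
    by (simp add: lie_add_right lie_scale_right)
  have "w \<in> lie x ` V" if "w \<in> V" for w
  proof -
    have "w \<in> span {lie x u, lie x v}" using V_sub that by (rule subsetD)
    then obtain a b where w: "w = lie x (a *s u + b *s v)"
      unfolding mem_span_pair_iff lie_comb by blast
    have "a *s u + b *s v \<in> V" unfolding xuv(1) mem_span_pair_iff by blast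
    then show ?thesis unfolding w by (rule imageI)
  qed
  then have surj: "lie x ` V = V" using inV by auto
  have "inj_on (lie x) V"
  proof (rule inj_onI)
    fix s t assume "s \<in> V" "t \<in> V" and eq: "lie x s = lie x t"
    then have "s - t \<in> V" using subV by (simp add: subspace_diff)
    then obtain a b where ab: "s - t = a *s u + b *s v"
      unfolding xuv(1) mem_span_pair_iff by blast
    have "lie x (s - t) = 0"
      using lie_add_right[of x "s - t" t] eq by simp
    then have "a = 0 \<and> b = 0"
      using coefficients_zero_if_span_pair_not_line[OF nl] lie_comb ab by metis
    then show "s = t" using ab by simp
  qed
  then have bij: "bij_betw (lie x) V V" using surj by (simp add: bij_betw_def)
  have abel: "lie s t = 0" if "s \<in> V" "t \<in> V" for s t
    using lie_span_pair[of s u v t] that xuv(1) uv by simp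
  have "poisson_abelian_extension scale lie V x"
    by unfold_locales
      (fact subV not_subset_line_if_dim_2[OF dimV] xuv(2) dec bij | erule (1) abel)+
  then show ?thesis by (rule that)
qed

lemma direct_sum_line_hyperplane:
  assumes "subspace V" "x \<notin> V" and dec: "\<And>y. \<exists>a. y - a *s x \<in> V"
  shows "is_direct_sum UNIV (span {x}) V"
  unfolding is_direct_sum_def
proof (intro conjI)
  have "a *s x = 0" if "a *s x \<in> V" for a
  proof (rule ccontr)
    assume "a *s x \<noteq> 0"
    then have "x = inverse a *s (a *s x)" by auto
    then show False using assms(2) subspace_scale[OF assms(1) that] by metis
  qed
  then show "span {x} \<inter> V = {0}"
    using subspace_0[OF assms(1)] by (auto simp: mem_span_singleton_iff span_zero)
  have "\<exists>s t. y = s + t \<and> s \<in> span {x} \<and> t \<in> V" for y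
  proof -
    obtain a where "y - a *s x \<in> V" using dec by blast
    then show ?thesis
      by (intro exI[of _ "a *s x"] exI[of _ "y - a *s x"]) (simp add: span_base span_scale)
  qed
  then show "UNIV = {s + t |s t. s \<in> span {x} \<and> t \<in> V}" by blast
qed (use assms in auto)

lemma basis_if_plane_complement:
  assumes "V = span {u, v}" "dim V = 2" "x \<notin> V" and dec: "\<And>y. \<exists>a. y - a *s x \<in> V"
  shows "distinct [x, u, v]" "independent {x, u, v}" "span {x, u, v} = UNIV"
proof -
  have not_line: "\<not> {u, v} \<subseteq> span {w}" for w
    using not_subset_line_if_dim_2[OF assms(2), of w] span_minimal[of "{u, v}" "span {w}"]
    unfolding assms(1) by auto
  have "u \<noteq> 0" using not_line[of v] by (auto simp: span_zero span_base)
  moreover have v: "v \<notin> span {u}" using not_line[of u] by (auto simp: span_base)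
  ultimately have "independent {u, v}" by (rule independent_pair)
  then show "independent {x, u, v}"
    using assms(1,3) by (simp add: independent_insert[of x])
  show "distinct [x, u, v]"
    using v assms(1,3) span_base[of u "{u, v}"] span_base[of v "{u, v}"] span_base[of u "{u}"] by auto
  show "span {x, u, v} = UNIV"
    using dec unfolding span_insert[of x] assms(1) by auto
qed

end

theorem theorem5p5:
  fixes scale :: "'f::field \<Rightarrow> 'p::comm_ring \<Rightarrow> 'p" (infixr \<open>*s\<close> 75)
    and lie :: "'p \<Rightarrow> 'p \<Rightarrow> 'p"
    and V :: "'p set"
  assumes "poisson_algebra scale lie"
    and "vector_space.dim scale (UNIV :: 'p set) = 3"
    and "V = vector_space.bracket_span scale lie UNIV UNIV"
    and "vector_space.dim scale V = 2"
  shows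
    "vector_space.bracket_span scale lie V V = {0} \<and>
     (\<exists>x A. x \<notin> V \<and>
        vector_space.is_direct_sum scale UNIV (module.span scale {x}) V \<and>
        A \<in> vector_space.general_linear scale V \<and>
        (\<forall>v\<in>V. lie x v = A v)) \<and>
     (CHAR('f) \<noteq> 2 \<longrightarrow> (\<forall>a b :: 'p. a * b = 0)) \<and>
     (CHAR('f) = 2 \<longrightarrow>
        (\<forall>a b :: 'p. a * b = 0) \<or>
        (\<exists>x u v :: 'p. \<exists>q :: 'f.
           distinct [x, u, v] \<and>
           \<not> module.dependent scale {x, u, v} \<and>
           module.span scale {x, u, v} = UNIV \<and>
           lie x u = u \<and> lie x v = v + q *s u \<and> lie u v = 0 \<and>
           x * v = u \<and> v * x = u \<and>
           x * x = 0 \<and> x * u = 0 \<and> u * x = 0 \<and>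
           u * u = 0 \<and> u * v = 0 \<and> v * u = 0 \<and> v * v = 0))"
proof -
  interpret poisson_algebra scale lie by fact
  have V: "V = bracket_span lie UNIV UNIV" and U: "dim (UNIV :: 'p set) = 3" and dimV: "dim V = 2"
    using assms by simp_all
  obtain x where "poisson_abelian_extension scale lie V x"
    using abelian_extension_if_derived_plane[OF U V dimV] .
  then interpret poisson_abelian_extension scale lie V x .
  have "bracket_span lie V V \<subseteq> span {}"
    by (rule bracket_span_subset) (simp add: lie_V)
  then have abelian: "bracket_span lie V V = {0}"
    unfolding bracket_span_def using span_zero by auto
  have "lie x \<in> general_linear V"
    using lie_x_bij by (simp add: general_linear_def lie_add_right lie_scale_right)
  then have split: "\<exists>x A. x \<notin> V \<and> is_direct_sum UNIV (span {x}) V \<and>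
      A \<in> general_linear V \<and> (\<forall>v\<in>V. lie x v = A v)"
    using x_notin direct_sum_line_hyperplane[OF subspace_V x_notin decompose] by blast
  have normal_form: "\<exists>x u v q. distinct [x, u, v] \<and> independent {x, u, v} \<and> span {x, u, v} = UNIV \<and>
      lie x u = u \<and> lie x v = v + q *s u \<and> lie u v = 0 \<and> x * v = u \<and> v * x = u \<and>
      x * x = 0 \<and> x * u = 0 \<and> u * x = 0 \<and> u * u = 0 \<and> u * v = 0 \<and> v * u = 0 \<and> v * v = 0"
    if nz: "a * b \<noteq> 0" for a b :: 'p
  proof -
    obtain u v y q where *:
      "V = span {u, v}" "y \<notin> V" "\<forall>z. \<exists>a. z - a *s y \<in> V"
      "lie y u = u" "lie y v = v + q *s u" "lie u v = 0" "y * v = u"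
      "y * y = 0" "y * u = 0" "u * u = 0" "u * v = 0" "v * v = 0"
      using nonzero_product_normal_form[OF dimV nz] .
    show ?thesis
      using basis_if_plane_complement[OF *(1) dimV *(2) *(3)[rule_format]] *(4-)
      by (intro exI[of _ y] exI[of _ u] exI[of _ v] exI[of _ q]) (simp add: mult.commute)
  qed
  have dichotomy: "(\<forall>a b :: 'p. a * b = 0) \<or> (\<exists>x u v q. distinct [x, u, v] \<and> independent {x, u, v} \<and> span {x, u, v} = UNIV \<and>
      lie x u = u \<and> lie x v = v + q *s u \<and> lie u v = 0 \<and> x * v = u \<and> v * x = u \<and>
      x * x = 0 \<and> x * u = 0 \<and> u * x = 0 \<and> u * u = 0 \<and> u * v = 0 \<and> v * u = 0 \<and> v * v = 0)"
    using normal_form by blast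
  show ?thesis
    by (intro conjI impI abelian split dichotomy allI mult_zero_if_char_neq_2)
qed

end
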